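(* Consider the graphs $X^{(m)}$, $m\ge1$, of the Dendrite/anti-Rabbit mating described in the context, with energies $E^{(m)}_1,E^{(m)}_2,E^{(m)}_3$. For every $m\ge2$ and every function $u$ on $X^{(m-1)}$, the harmonic extension $\tilde u$ of $u$ to $X^{(m)}$ satisfies $$E_1^{(m)}(\tilde u)=4E_3^{(m-1)}(u),\qquad E_2^{(m)}(\tilde u)=E_1^{(m-1)}(u),\qquad E_3^{(m)}(\tilde u)=E_2^{(m-1)}(u).$$ Consequently, the renormalized energies $$\mathcal{E}^{(m)}(u)=4^{-\frac m3}\left(E_1^{(m)}(u)+4^{\frac13}E_2^{(m)}(u)+4^{\frac23}E_3^{(m)}(u)\right)$$ satisfy $\mathcal{E}^{(m)}(\tilde u)=\mathcal{E}^{(m-1)}(u)$ for every $m\ge 2$ and every function $u$ on $X^{(m-1)}$.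
   Context: The circle is $\mathbb{R}/\mathbb{Z}$. The underlying set of points of $X^{(m)}$ is $\left\{\frac{2^n+7\ell}{7\cdot 2^m}\bmod 1: n=1,2,3,\ 0\le\ell\le 2^m-1\right\}$. Identifications. The Rabbit identification (this is the anti-Rabbit identification transported by $t\mapsto1-t$): two points are identified if they have the same kneading sequence with respect to the two arcs $(\frac1{14},\frac47]$ and $(\frac47,\frac1{14}+1]$, where the kneading sequence of $t$ records for each $j\ge0$ which arc contains $2^jt\bmod1$. The Dendrite identification on these points: two points are identified if they have the same kneading sequence with respect to the two arcs $(\frac1{12},\frac7{12}]$ and $(\frac7{12},\frac1{12}+1]$. In the mating, points of $X^{(m)}$ are identified according to the equivalence relation generated by both identifications; the vertices of the graph $X^{(m)}$ are the equivalence classes. The edges are the closed arcs $[x,y]$ between neighbouring points of the underlying set (arcs with identified endpoints are loops). An edge is of type $j\in\{1,2,3\}$ if its length $|x-y|$ is $\frac{2^{j-1}}{7\cdot2^m}$. A function on $X^{(m)}$ is a real function on the underlying points taking equal values at identified points, and $$E_j^{(m)}(u)=\sum_{[x,y]\text{ of type }j}\frac{|u(x)-u(y)|^2}{|x-y|}.$$ The harmonic extension $\tilde u$ of a function $u$ on $X^{(m-1)}$ is the extension of $u$ to $X^{(m)}$ that minimizes $E_1^{(m)}+4^{\frac13}E_2^{(m)}+4^{\frac23}E_3^{(m)}$ among all extensions. *)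

theory Defs
  imports Complex_Main "HOL-Library.FuncSet"
begin

text \<open>The circle \<open>\<real>/\<int>\<close> is represented by the fundamental domain \<open>{0..<1}\<close>, with
  \<^term>\<open>frac\<close> as reduction modulo 1.\<close>

definition points :: "nat \<Rightarrow> real set" where
  "points m = {frac ((2 ^ n + 7 * real l) / (7 * 2 ^ m)) |n l. n \<in> {1, 2, 3} \<and> l \<le> 2 ^ m - 1}"

definition circle_arc :: "real \<Rightarrow> real \<Rightarrow> real set" where
  "circle_arc a b = frac ` {a<..b}"

lemma circle_arc_complement:
  assumes "a < b" "b < a + 1"
  shows "circle_arc b (a + 1) = {0..<1} - circle_arc a b"
proof -
  have disj: False if "frac s = frac t" "a < s" "s \<le> b" "b < t" "t \<le> a + 1" for s t :: real
  proof -
    from that(1) have "t - s = real_of_int (\<lfloor>t\<rfloor> - \<lfloor>s\<rfloor>)"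
      by (simp add: frac_def)
    moreover have "0 < t - s" "t - s < 1" using that by auto
    ultimately show False by (metis of_int_0_less_iff of_int_less_1_iff zless_imp_add1_zle
          add_0 not_less)
  qed
  have cov: "x \<in> frac ` {a<..b} \<union> frac ` {b<..a + 1}" if "x \<in> {0..<1}" for x
  proof -
    define s where "s = x + of_int (- \<lceil>x - a\<rceil> + 1)"
    have "frac s = x" using that unfolding s_def by (subst frac_unique_iff) auto
    moreover have "a < s \<and> s \<le> a + 1" unfolding s_def by simp linarith
    ultimately show ?thesis
      by (cases "s \<le> b") (auto intro!: image_eqI[of x frac s])
  qed
  show ?thesis
    unfolding circle_arc_def using disj cov by (fastforce simp: frac_lt_1)
qed

text \<open>The arcs \<open>(a, b]\<close> and \<open>(b, a + 1]\<close> partition the circle (lemma \<open>circle_arc_complement\<close>), so a Boolean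
  records which of the two contains the \<open>j\<close>-th iterate: \<^const>\<open>True\<close> stands for \<open>(a, b]\<close>.\<close>

definition kneading :: "real \<Rightarrow> real \<Rightarrow> real \<Rightarrow> nat \<Rightarrow> bool" where
  "kneading a b t = (\<lambda>j. frac (2 ^ j * t) \<in> circle_arc a b)"

definition kneading_ident :: "real \<Rightarrow> real \<Rightarrow> nat \<Rightarrow> (real \<times> real) set" where
  "kneading_ident a b m = {(x, y). x \<in> points m \<and> y \<in> points m \<and> kneading a b x = kneading a b y}"

definition rabbit_ident :: "nat \<Rightarrow> (real \<times> real) set" where
  "rabbit_ident = kneading_ident (1/14) (4/7)"

definition dendrite_ident :: "nat \<Rightarrow> (real \<times> real) set" where
  "dendrite_ident = kneading_ident (1/12) (7/12)"

definition mating_ident :: "nat \<Rightarrow> (real \<times> real) set" where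
  "mating_ident m = \<Inter>{r. equiv (points m) r \<and> rabbit_ident m \<union> dendrite_ident m \<subseteq> r}"

text \<open>An edge is the closed arc running counterclockwise from \<open>x\<close> to the next point \<open>y\<close>; it is
  stored as the ordered pair \<open>(x, y)\<close>, so that every arc occurs exactly once, and its length
  \<open>\<bar>x - y\<bar>\<close> on the circle is \<open>frac (y - x)\<close>. Endpoints are underlying points rather than
  equivalence classes: loops and parallel edges are thus kept apart.\<close>

definition edges :: "nat \<Rightarrow> (real \<times> real) set" where
  "edges m = {(x, y). x \<in> points m \<and> y \<in> points m \<and> x \<noteq> y \<and>
     \<not> (\<exists>z \<in> points m. 0 < frac (z - x) \<and> frac (z - x) < frac (y - x))}"

definition edges_of_type :: "nat \<Rightarrow> nat \<Rightarrow> (real \<times> real) set" where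
  "edges_of_type j m = {(x, y) \<in> edges m. frac (y - x) = 2 ^ (j - 1) / (7 * 2 ^ m)}"

definition graph_functions :: "nat \<Rightarrow> (real \<Rightarrow> real) set" where
  "graph_functions m = {u \<in> extensional (points m). \<forall>(x, y) \<in> mating_ident m. u x = u y}"

definition energy :: "nat \<Rightarrow> nat \<Rightarrow> (real \<Rightarrow> real) \<Rightarrow> real" where
  "energy j m u = (\<Sum>(x, y) \<in> edges_of_type j m. \<bar>u x - u y\<bar>\<^sup>2 / frac (y - x))"

definition weighted_energy :: "nat \<Rightarrow> (real \<Rightarrow> real) \<Rightarrow> real" where
  "weighted_energy m u =
     energy 1 m u + 4 powr (1/3) * energy 2 m u + 4 powr (2/3) * energy 3 m u"

definition renormalized_energy :: "nat \<Rightarrow> (real \<Rightarrow> real) \<Rightarrow> real" where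
  "renormalized_energy m u = 4 powr (- real m / 3) * weighted_energy m u"

text \<open>\<open>points (m - 1) \<subseteq> points m\<close>, since \<open>2 ^ n mod 7\<close> has period 3 in \<open>n\<close>.\<close>

definition extensions :: "nat \<Rightarrow> (real \<Rightarrow> real) \<Rightarrow> (real \<Rightarrow> real) set" where
  "extensions m u = {v \<in> graph_functions m. \<forall>x \<in> points (m - 1). v x = u x}"

definition is_harmonic_extension :: "nat \<Rightarrow> (real \<Rightarrow> real) \<Rightarrow> (real \<Rightarrow> real) \<Rightarrow> bool" where
  "is_harmonic_extension m u v \<longleftrightarrow>
     v \<in> extensions m u \<and> (\<forall>w \<in> extensions m u. weighted_energy m v \<le> weighted_energy m w)"

end

theory Submission
  imports Defs
begin

text \<open>In units of \<open>1 / (7 \<cdot> 2 ^ m)\<close> the points of level \<open>m\<close> are the integers congruent to 1, 2 or 4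
  modulo 7, and an edge starting at \<open>k\<close> has length \<open>k mod 7\<close>. Passing to the next level doubles the
  coordinates: edges of type 1 and 2 become edges of type 2 and 3, and an edge of type 3 becomes an
  arc \<open>[a, a + 8]\<close> with three new points \<open>a + 1\<close>, \<open>a + 3\<close>, \<open>a + 7\<close>, which the Rabbit identification
  glues together. The energy of an extension is therefore a constant plus, for every such gap, the
  energy of two equal resistors in series, minimal exactly when the new value is the mean of the
  values at \<open>a\<close> and \<open>a + 8\<close>. This mean value is compatible with the Dendrite identification
  because points in two gaps are identified only if the pairs of endpoints of the two gaps are
  identified as well, possibly crosswise.\<close>

section \<open>Integer coordinates\<close>

definition pt :: "nat \<Rightarrow> int \<Rightarrow> real" where
  "pt m k = frac (of_int k / (7 * 2 ^ m))"

definition adm :: "int set" where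
  "adm = {k. k mod 7 \<in> {1, 2, 4}}"

lemma pt_mod: "pt m k = of_int (k mod (7 * 2 ^ m)) / (7 * 2 ^ m)"
proof -
  have "\<lfloor>of_int k / (7 * 2 ^ m) :: real\<rfloor> = k div (7 * 2 ^ m)"
    using floor_divide_of_int_eq[of k "7 * 2 ^ m", where 'a = real] by simp
  moreover have "real_of_int (k mod (7 * 2 ^ m))
      = of_int k - of_int (k div (7 * 2 ^ m)) * (7 * 2 ^ m)"
    by (subst minus_div_mult_eq_mod [symmetric]) simp
  ultimately show ?thesis
    unfolding pt_def frac_def by (simp add: field_simps)
qed

lemma pt_eq_iff: "pt m k = pt m l \<longleftrightarrow> k mod (7 * 2 ^ m) = l mod (7 * 2 ^ m)"
  unfolding pt_mod by simp

lemma pt_add_period [simp]: "pt m (k + 7 * 2 ^ m * s) = pt m k"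
  by (simp add: pt_eq_iff)

lemma pt_Suc_double: "pt (Suc m) (2 * k) = pt m k"
  unfolding pt_def by simp

lemma frac_pt_diff: "frac (pt m l - pt m k) = pt m (l - k)"
  unfolding pt_def frac_diff_simp
  using frac_add_simps(1)[of "of_int l / (7 * 2 ^ m)" "- (of_int k / (7 * 2 ^ m))"]
  by (simp add: diff_divide_distrib)

lemma pow2_mod_7:
  assumes "i < (3::nat)" 
  shows "(7 * l + 2 ^ i :: int) mod 7 = 2 ^ i"
  using assms by (auto simp: less_Suc_eq numeral_3_eq_3)

lemma pow2_in_adm: "i < 3 \<Longrightarrow> 7 * l + 2 ^ i \<in> adm"
  unfolding adm_def using pow2_mod_7[of i l] by (auto simp: less_Suc_eq numeral_3_eq_3)

text \<open>The numerators 2, 4 and 8 of the definition have residues 2, 4 and 1 modulo 7.\<close>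

lemma points_eq: "points m = pt m ` adm"
proof (intro equalityI subsetI)
  fix x assume "x \<in> points m"
  then obtain n l where n: "n \<in> {1, 2, 3::nat}" and x: "x = frac ((2 ^ n + 7 * real l) / (7 * 2 ^ m))"
    unfolding points_def by blast
  have "x = pt m (2 ^ n + 7 * int l)"
    unfolding x pt_def by simp
  moreover have "2 ^ n + 7 * int l \<in> adm"
    using n unfolding adm_def by (auto simp: mod_simps)
  ultimately show "x \<in> pt m ` adm" by blast
next
  fix x assume "x \<in> pt m ` adm"
  then obtain k where k: "k \<in> adm" and x: "x = pt m k" by blast
  obtain n where n: "n \<in> {1, 2, 3::nat}" "k mod 7 = 2 ^ n mod 7"
  proof -
    consider "k mod 7 = 1" | "k mod 7 = 2" | "k mod 7 = 4" using k by (auto simp: adm_def)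
    then show ?thesis by cases (use that[of 1] that[of 2] that[of 3] in auto)
  qed
  then obtain q where q: "k = 2 ^ n + 7 * q"
    by (metis mod_eqE mult.commute)
  \<comment> \<open>Adding \<open>2 ^ m\<close> to \<open>l\<close> is a full turn, so
    \<open>q\<close> may be reduced to the range required by \<open>points_def\<close>.\<close>
  define l where "l = nat (q mod 2 ^ m)"
  have l: "int l = q mod 2 ^ m" unfolding l_def by simp
  have "l < 2 ^ m" unfolding l_def by (simp add: nat_less_iff)
  then have "l \<le> 2 ^ m - 1" by simp
  have "k = (2 ^ n + 7 * int l) + 7 * 2 ^ m * (q div 2 ^ m)"
    unfolding q l minus_mult_div_eq_mod [symmetric] by (simp add: algebra_simps)
  then have "x = pt m (2 ^ n + 7 * int l)"
    unfolding x using pt_add_period by metis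
  also have "\<dots> = frac ((2 ^ n + 7 * real l) / (7 * 2 ^ m))"
    unfolding pt_def by simp
  finally show "x \<in> points m"
    unfolding points_def using n \<open>l \<le> 2 ^ m - 1\<close> by blast
qed

text \<open>Stepping from residue \<open>r\<close> by \<open>r\<close> runs through 1, 2, 4, 8 = 1
  modulo 7, and the residues skipped on the way are 3, 5, 6, 0, none of them admissible. The step is
  at most 4, less than a full turn even for \<open>m = 0\<close>.\<close>

lemma edges_eq: "edges m = (\<lambda>k. (pt m k, pt m (k + k mod 7))) ` adm"
proof -
  have small: "(k mod 7) mod (7 * 2 ^ m) = k mod 7" for k :: int
  proof -
    have "k mod 7 < 7" by simp
    also have "(7::int) \<le> 7 * 2 ^ m" by simp
    finally show ?thesis by simp
  qed
  have no_pt: "l \<notin> adm" if "k \<in> adm" "0 < (l - k) mod (7 * 2 ^ m)" "(l - k) mod (7 * 2 ^ m) < k mod 7" for k l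
  proof -
    define d where "d = (l - k) mod (7 * 2 ^ m)"
    have "d mod 7 = (l - k) mod 7" unfolding d_def by (simp add: mod_mod_cancel)
    then have "l mod 7 = (k mod 7 + d) mod 7"
      by (metis add.commute diff_add_cancel mod_add_eq mod_mod_trivial)
    moreover have "0 < d" "d < k mod 7" using that unfolding d_def by auto
    moreover have "k mod 7 \<in> {1, 2, 4}" using that(1) by (simp add: adm_def)
    ultimately have "k mod 7 = 2 \<and> d = 1 \<or> k mod 7 = 4 \<and> (d = 1 \<or> d = 2 \<or> d = 3)"
      by auto
    then have "l mod 7 \<in> {0, 3, 5, 6}" using \<open>l mod 7 = _\<close> by auto
    then show ?thesis by (auto simp: adm_def)
  qed
  have next_adm: "k + k mod 7 \<in> adm" if "k \<in> adm" for k
    using that unfolding adm_def by (auto; presburger)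
  show ?thesis
  proof (intro equalityI subsetI)
    fix e assume "e \<in> edges m"
    then obtain k l where kl: "k \<in> adm" "l \<in> adm" "e = (pt m k, pt m l)" "pt m k \<noteq> pt m l"
      and gap: "\<not> (\<exists>z \<in> pt m ` adm. 0 < frac (z - pt m k) \<and> frac (z - pt m k) < frac (pt m l - pt m k))"
      unfolding edges_def points_eq by blast
    have gap: "\<not> pt m (j - k) < pt m (l - k)" if "j \<in> adm" "0 < pt m (j - k)" for j
      using gap that unfolding frac_pt_diff [symmetric] by blast
    define d where "d = (l - k) mod (7 * 2 ^ m)"
    have "0 \<le> d" unfolding d_def by simp
    moreover have "d \<noteq> 0" using kl(4) unfolding d_def pt_eq_iff
      by (simp add: mod_eq_dvd_iff dvd_eq_mod_eq_0 [symmetric] dvd_diff_commute)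
    ultimately have "0 < d" by simp
    have "0 < k mod 7" using kl(1) by (auto simp: adm_def)
    then have "\<not> k mod 7 < d"
      using gap[OF next_adm[OF kl(1)]] unfolding pt_mod d_def add_diff_cancel_left' small
      by (simp add: divide_less_cancel)
    moreover have "\<not> d < k mod 7"
      using no_pt[OF kl(1), of l] kl(2) \<open>0 < d\<close> unfolding d_def by blast
    ultimately have "(l - k) mod (7 * 2 ^ m) = k mod 7" unfolding d_def by simp
    then have "l mod (7 * 2 ^ m) = (k + k mod 7) mod (7 * 2 ^ m)"
      by (metis add.commute diff_add_cancel mod_add_right_eq)
    then show "e \<in> (\<lambda>k. (pt m k, pt m (k + k mod 7))) ` adm"
      using kl by (auto simp: pt_eq_iff)
  next
    fix e assume "e \<in> (\<lambda>k. (pt m k, pt m (k + k mod 7))) ` adm"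
    then obtain k where k: "k \<in> adm" "e = (pt m k, pt m (k + k mod 7))" by blast
    have pos: "0 < k mod 7" using k(1) by (auto simp: adm_def)
    have "pt m k \<noteq> pt m (k + k mod 7)"
    proof
      assume "pt m k = pt m (k + k mod 7)"
      then have "pt m (k + k mod 7 - k) = 0"
        unfolding frac_pt_diff [symmetric] by simp
      then show False using pos by (simp add: pt_mod small)
    qed
    moreover have "\<not> (0 < pt m (j - k) \<and> pt m (j - k) < pt m (k + k mod 7 - k))" if "j \<in> adm" for j
      using no_pt[OF k(1), of j] that
      by (auto simp: pt_mod small divide_less_cancel zero_less_divide_iff)
    ultimately show "e \<in> edges m"
      unfolding edges_def points_eq using k next_adm[OF k(1)] by (auto simp: frac_pt_diff simp del: frac_gt_0_iff)
  qed
qed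

lemma edges_of_type_eq:
  assumes "i < 3"
  shows "edges_of_type (Suc i) m
    = (\<lambda>l. (pt m (7 * int l + 2 ^ i), pt m (7 * int l + 2 ^ Suc i))) ` {..<2 ^ m}"
proof -
  have small: "2 ^ i mod (7 * 2 ^ m :: int) = 2 ^ i"
  proof -
    have "(2 ^ i :: int) < 7" using assms by (auto simp: less_Suc_eq numeral_3_eq_3)
    also have "(7::int) \<le> 7 * 2 ^ m" by simp
    finally show ?thesis by simp
  qed
  have len: "pt m (k mod 7) = 2 ^ i / (7 * 2 ^ m) \<longleftrightarrow> k mod 7 = 2 ^ i" for k
  proof -
    have "k mod 7 < 7" by simp
    also have "(7::int) \<le> 7 * 2 ^ m" by simp
    finally have "(k mod 7) mod (7 * 2 ^ m) = k mod 7" by simp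
    moreover have "real_of_int (k mod 7) = 2 ^ i \<longleftrightarrow> k mod 7 = 2 ^ i"
      by (metis of_int_eq_iff of_int_power of_int_numeral)
    ultimately show ?thesis by (simp add: pt_mod)
  qed
  have "edges_of_type (Suc i) m = (\<lambda>k. (pt m k, pt m (k + k mod 7))) ` {k. k mod 7 = 2 ^ i}"
    (is "?L = ?R")
  proof (intro equalityI subsetI)
    fix e assume "e \<in> ?L"
    then show "e \<in> ?R"
      unfolding edges_of_type_def edges_eq by (auto simp: frac_pt_diff len)
  next
    fix e assume "e \<in> ?R"
    then obtain k where k: "k mod 7 = 2 ^ i" "e = (pt m k, pt m (k + k mod 7))" by blast
    have "k \<in> adm" using k assms by (auto simp: adm_def less_Suc_eq numeral_3_eq_3)
    then show "e \<in> ?L"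
      unfolding edges_of_type_def edges_eq using k len[of k] by (auto simp: frac_pt_diff)
  qed
  also have "\<dots> = (\<lambda>l. (pt m (7 * int l + 2 ^ i), pt m (7 * int l + 2 ^ Suc i))) ` {..<2 ^ m}"
    (is "_ = ?S")
  proof (intro equalityI subsetI)
    fix e assume "e \<in> ?R"
    then obtain k where k: "k mod 7 = 2 ^ i" "e = (pt m k, pt m (k + k mod 7))" by blast
    define l where "l = nat ((k div 7) mod 2 ^ m)"
    have l: "int l = (k div 7) mod 2 ^ m" unfolding l_def by simp
    have "l < 2 ^ m" unfolding l_def by (simp add: nat_less_iff)
    have "k = 7 * (k div 7) + 2 ^ i" using mult_div_mod_eq[of 7 k] k(1) by simp
    also have "k div 7 = int l + 2 ^ m * (k div 7 div 2 ^ m)"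
      unfolding l by simp
    finally have "k = (7 * int l + 2 ^ i) + 7 * 2 ^ m * (k div 7 div 2 ^ m)"
      by (simp add: algebra_simps)
    then have "pt m (k + x) = pt m ((7 * int l + 2 ^ i) + x)" for x
      by (metis pt_add_period add.assoc add.commute)
    from this[of 0] this[of "2 ^ i"] show "e \<in> ?S"
      using k \<open>l < 2 ^ m\<close> by (auto simp: algebra_simps)
  next
    fix e assume "e \<in> ?S"
    then obtain l where l: "e = (pt m (7 * int l + 2 ^ i), pt m (7 * int l + 2 ^ Suc i))" by blast
    show "e \<in> ?R"
      by (rule image_eqI[of _ _ "7 * int l + 2 ^ i"])
         (use pow2_mod_7[OF assms, of "int l"] in \<open>simp_all add: l ac_simps\<close>)
  qed
  finally show ?thesis .
qed

text \<open>The prefactor is the reciprocal of the common length. Edges are told apart by their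
  starting points alone, which lie in one period; the end \<open>7 * l + 8\<close> of an edge of
  type 3 may wrap around.\<close>

lemma energy_eq:
  assumes "i < 3"
  shows "energy (Suc i) m u =
    7 * 2 ^ m / 2 ^ i * (\<Sum>l<2 ^ m. (u (pt m (7 * int l + 2 ^ i)) - u (pt m (7 * int l + 2 ^ Suc i)))\<^sup>2)"
proof -
  let ?f = "\<lambda>l. (pt m (7 * int l + 2 ^ i), pt m (7 * int l + 2 ^ Suc i))"
  have small: "(7 * int l + 2 ^ i) mod (7 * 2 ^ m) = 7 * int l + 2 ^ i" if "l < 2 ^ m" for l
  proof -
    have "int l + 1 \<le> 2 ^ m" using that
      by (metis of_nat_less_iff of_nat_numeral of_nat_power zless_imp_add1_zle)
    moreover have "(2::int) ^ i < 7" using assms by (auto simp: less_Suc_eq numeral_3_eq_3)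
    ultimately have "7 * int l + 2 ^ i < 7 * 2 ^ m" by linarith
    then show ?thesis by simp
  qed
  have "inj_on ?f {..<2 ^ m}"
    by (rule inj_onI) (auto simp: pt_eq_iff small)
  moreover have len: "frac (pt m (7 * int l + 2 ^ Suc i) - pt m (7 * int l + 2 ^ i)) = 2 ^ i / (7 * 2 ^ m)" for l
  proof -
    have "frac (pt m (7 * int l + 2 ^ Suc i) - pt m (7 * int l + 2 ^ i)) = pt m (2 ^ i)"
      by (simp add: frac_pt_diff)
    also have "\<dots> = 2 ^ i / (7 * 2 ^ m)"
      using small[of 0] by (simp add: pt_mod)
    finally show ?thesis .
  qed
  ultimately have "energy (Suc i) m u
      = (\<Sum>l<2 ^ m. \<bar>u (pt m (7 * int l + 2 ^ i)) - u (pt m (7 * int l + 2 ^ Suc i))\<bar>\<^sup>2 / (2 ^ i / (7 * 2 ^ m)))"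
    unfolding energy_def edges_of_type_eq[OF assms]
    by (subst sum.reindex) (simp_all add: o_def)
  then show ?thesis
    by (simp add: sum_distrib_left sum_divide_distrib mult.commute)
qed

section \<open>Kneading sequences\<close>

lemma in_circle_arc_iff:
  assumes "0 \<le> a" "b < 1" "0 \<le> x" "x < 1"
  shows "x \<in> circle_arc a b \<longleftrightarrow> a < x \<and> x \<le> b"
proof -
  have "frac s = s" if "a < s" "s \<le> b" for s
    using that assms by (simp add: frac_eq)
  then show ?thesis
    unfolding circle_arc_def using assms by (auto intro!: image_eqI[of x frac x])
qed

text \<open>The number of the arc of length \<open>1/2\<close>, counted along the real line from \<open>(\<alpha> - 1/2, \<alpha>]\<close>, that
  contains the point; its parity is the first letter of the kneading sequence.\<close>

definition half_index :: "real \<Rightarrow> nat \<Rightarrow> int \<Rightarrow> int" where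
  "half_index \<alpha> m k = \<lceil>2 * (of_int k / (7 * 2 ^ m) - \<alpha>)\<rceil>"

abbreviation knead :: "real \<Rightarrow> nat \<Rightarrow> int \<Rightarrow> nat \<Rightarrow> bool" where
  "knead \<alpha> m k \<equiv> kneading \<alpha> (\<alpha> + 1/2) (pt m k)"

lemma kneading_frac: "kneading a b (frac t) = kneading a b t"
proof
  fix j
  have "2 ^ j * frac t = 2 ^ j * t + of_int (- (2 ^ j * \<lfloor>t\<rfloor>))"
    by (simp add: frac_def algebra_simps)
  then show "kneading a b (frac t) j = kneading a b t j"
    unfolding kneading_def by (simp only: frac_add_of_int_right)
qed

text \<open>A full turn changes the index by 2 and keeps its parity. On the fundamental domain the
  index is 0, 1 or 2, and 1 means the arc \<open>(\<alpha>, \<alpha> + 1/2]\<close>.\<close>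

lemma knead_0_iff:
  assumes "0 \<le> \<alpha>" "\<alpha> < 1/2"
  shows "knead \<alpha> m k 0 \<longleftrightarrow> odd (half_index \<alpha> m k)"
proof -
  define t where "t = (of_int k / (7 * 2 ^ m) :: real)"
  have "half_index \<alpha> m k = \<lceil>2 * (frac t - \<alpha>)\<rceil> + 2 * \<lfloor>t\<rfloor>"
  proof -
    have "2 * (t - \<alpha>) = 2 * (frac t - \<alpha>) + of_int (2 * \<lfloor>t\<rfloor>)"
      by (simp add: frac_def)
    then show ?thesis
      unfolding half_index_def t_def [symmetric] by (simp only: ceiling_add_of_int)
  qed
  then have "odd (half_index \<alpha> m k) \<longleftrightarrow> odd \<lceil>2 * (frac t - \<alpha>)\<rceil>" by simp
  also have "\<dots> \<longleftrightarrow> \<lceil>2 * (frac t - \<alpha>)\<rceil> = 1"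
  proof -
    have "-1 < 2 * (x - \<alpha>)" if "0 \<le> x" for x
      using assms that by argo
    then have "-1 < 2 * (frac t - \<alpha>)" by simp
    moreover have "2 * (frac t - \<alpha>) \<le> 2"
      using assms frac_lt_1[of t] by argo
    ultimately have "-1 < \<lceil>2 * (frac t - \<alpha>)\<rceil>" "\<lceil>2 * (frac t - \<alpha>)\<rceil> \<le> 2"
      by (simp_all add: less_ceiling_iff ceiling_le_iff)
    then have "\<lceil>2 * (frac t - \<alpha>)\<rceil> = 0 \<or> \<lceil>2 * (frac t - \<alpha>)\<rceil> = 1
        \<or> \<lceil>2 * (frac t - \<alpha>)\<rceil> = 2"
      by linarith
    then show ?thesis by (elim disjE) simp_all
  qed
  also have "\<dots> \<longleftrightarrow> \<alpha> < frac t \<and> frac t \<le> \<alpha> + 1/2"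
    by (simp add: ceiling_eq_iff) linarith
  also have "\<dots> \<longleftrightarrow> knead \<alpha> m k 0"
    unfolding kneading_frac pt_def t_def [symmetric] unfolding kneading_def
    using in_circle_arc_iff[of \<alpha> "\<alpha> + 1/2" "frac t"] assms by (simp add: frac_lt_1)
  finally show ?thesis ..
qed

text \<open>Doubling the angle keeps the integer coordinate and lowers the level by one, so the
  shift of kneading sequences becomes a step in the level. All inductions on the level rest on
  this.\<close>

lemma knead_Suc: "kneading a b (pt (Suc m) k) (Suc j) = kneading a b (pt m k) j"
  unfolding pt_def kneading_frac unfolding kneading_def by (simp add: field_simps)

lemma all_nat_iff: "(\<forall>n. P n) \<longleftrightarrow> P 0 \<and> (\<forall>n. P (Suc n))"
  using not0_implies_Suc by metis

lemma knead_Suc_eq_iff: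
  "kneading a b (pt (Suc m) k) = kneading a b (pt (Suc m) l) \<longleftrightarrow>
    kneading a b (pt (Suc m) k) 0 = kneading a b (pt (Suc m) l) 0 \<and>
    kneading a b (pt m k) = kneading a b (pt m l)"
    (is "?f = ?g \<longleftrightarrow> _")
proof -
  have "?f = ?g \<longleftrightarrow> ?f 0 = ?g 0 \<and> (\<forall>j. ?f (Suc j) = ?g (Suc j))"
    by (subst fun_eq_iff, subst all_nat_iff) blast
  then show ?thesis by (simp add: knead_Suc fun_eq_iff)
qed

text \<open>Antipodal points lie in opposite arcs: \<open>7 * 2 ^ m\<close> units are half a turn at
  level \<open>Suc m\<close>.\<close>

lemma knead_half_shift:
  assumes "0 \<le> \<alpha>" "\<alpha> < 1/2"
  shows "knead \<alpha> (Suc m) (k + 7 * 2 ^ m) 0 \<longleftrightarrow> \<not> knead \<alpha> (Suc m) k 0"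
proof -
  have "2 * (of_int (k + 7 * 2 ^ m) / (7 * 2 ^ Suc m) - \<alpha>)
      = 2 * (of_int k / (7 * 2 ^ Suc m) - \<alpha>) + of_int 1"
    by (simp add: field_simps)
  then have "half_index \<alpha> (Suc m) (k + 7 * 2 ^ m) = half_index \<alpha> (Suc m) k + 1"
    unfolding half_index_def by (simp only: ceiling_add_of_int)
  then show ?thesis by (simp only: knead_0_iff[OF assms]) simp
qed

lemma mod_double_cases:
  fixes k l n :: int
  assumes "k mod n = l mod n" "n > 0"
  shows "k mod (2 * n) = l mod (2 * n) \<or> k mod (2 * n) = (l + n) mod (2 * n)"
proof -
  obtain s where s: "k = l + n * s" using assms(1) by (metis mod_eqE)
  show ?thesis
  proof (cases "even s")
    case True
    then obtain r where "s = 2 * r" by blast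
    then have "k = l + 2 * n * r" using s by simp
    then show ?thesis by simp
  next
    case False
    then obtain r where "s = 2 * r + 1" by (blast elim: oddE)
    then have "k = (l + n) + 2 * n * r" using s by (simp add: algebra_simps)
    then show ?thesis by simp
  qed
qed

lemma pt_eq_Suc_cases:
  assumes "pt m k = pt m l"
  shows "pt (Suc m) k = pt (Suc m) l \<or> pt (Suc m) k = pt (Suc m) (l + 7 * 2 ^ m)"
  using mod_double_cases[of k "7 * 2 ^ m" l] assms by (simp add: pt_eq_iff mult.left_commute)

text \<open>Doubling is injective on each of the two arcs, so a kneading sequence and a residue class
  modulo 7, which labels the points of level 0, determine the point.\<close>

lemma knead_inj:
  assumes "0 \<le> \<alpha>" "\<alpha> < 1/2" "knead \<alpha> m k = knead \<alpha> m l" "k mod 7 = l mod 7"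
  shows "pt m k = pt m l"
  using assms(3)
proof (induction m)
  case 0
  then show ?case using assms(4) by (simp add: pt_eq_iff)
next
  case (Suc m)
  then have "pt m k = pt m l" and eq: "knead \<alpha> (Suc m) k 0 = knead \<alpha> (Suc m) l 0"
    by (simp_all add: knead_Suc_eq_iff)
  then show ?case
    using pt_eq_Suc_cases[of m k l] knead_half_shift[OF assms(1,2), of m l] by auto
qed

section \<open>Kneading at levels 0 and 1, and parity\<close>

lemma adm_double: "2 * k \<in> adm \<longleftrightarrow> k \<in> adm"
proof -
  have "(2 * k) mod 7 = (2 * (k mod 7)) mod 7" by (simp add: mod_mult_right_eq)
  moreover have "0 \<le> k mod 7" "k mod 7 < 7" by simp_all
  then have "k mod 7 \<in> {0, 1, 2, 3, 4, 5, 6}" by auto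
  ultimately show ?thesis unfolding adm_def by auto
qed

text \<open>The points 1/7, 2/7, 4/7 are permuted by doubling. The bounds on \<open>\<alpha>\<close>
  put all three into the first arc: \<open>\<alpha> < 1/7\<close> at its open end,
  \<open>4/7 \<le> \<alpha> + 1/2\<close> at its closed end. Both \<open>1/14\<close> (Rabbit) and
  \<open>1/12\<close> (Dendrite) satisfy them.\<close>

lemma knead_level_0:
  assumes "1/14 \<le> \<alpha>" "\<alpha> < 1/7" "k \<in> adm"
  shows "knead \<alpha> 0 k = (\<lambda>_. True)"
proof
  fix j
  have "2 ^ j * k \<in> adm"
    using assms(3) by (induction j) (simp_all only: power_0 mult_1 power_Suc mult.assoc adm_double)
  then have "(2 ^ j * k) mod 7 \<in> {1, 2, 4}" by (simp add: adm_def)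
  moreover have "frac (2 ^ j * (of_int k / 7)) = (of_int ((2 ^ j * k) mod 7) / 7 :: real)"
    using pt_mod[of 0 "2 ^ j * k"] by (simp add: pt_def)
  ultimately have "frac (2 ^ j * (of_int k / 7)) \<in> {1/7, 2/7, 4/7 :: real}"
    by auto
  then have "\<alpha> < frac (2 ^ j * (of_int k / 7 :: real))" "frac (2 ^ j * (of_int k / 7)) \<le> \<alpha> + 1/2"
    using assms by auto
  then have "frac (2 ^ j * (of_int k / 7)) \<in> circle_arc \<alpha> (\<alpha> + 1/2)"
    using assms by (subst in_circle_arc_iff) (simp_all add: frac_lt_1)
  then show "knead \<alpha> 0 k j = True"
    unfolding pt_def kneading_frac unfolding kneading_def by simp
qed

text \<open>An even coordinate is a point of level 0; an odd one is antipodal to such a point, as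
  \<open>k + 7\<close> is even.\<close>

lemma knead_level_1:
  assumes "1/14 \<le> \<alpha>" "\<alpha> < 1/7" "k \<in> adm"
  shows "knead \<alpha> (Suc 0) k 0 \<longleftrightarrow> even k"
proof -
  have even: "knead \<alpha> (Suc 0) l 0" if "even l" "l \<in> adm" for l
  proof -
    obtain r where r: "l = 2 * r" using \<open>even l\<close> by (rule evenE)
    then show ?thesis
      using knead_level_0[OF assms(1,2), of r] that(2) by (simp add: pt_Suc_double adm_double del: One_nat_def)
  qed
  show ?thesis
  proof (cases "even k")
    case True
    then show ?thesis using even assms(3) by simp
  next
    case False
    then have "even (k + 7)" "k + 7 \<in> adm" using assms(3) by (simp_all add: adm_def)
    then have "knead \<alpha> (Suc 0) (k + 7) 0" by (rule even)
    then show ?thesis using False knead_half_shift[of \<alpha> 0 k] assms(1,2) by simp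
  qed
qed

lemma knead_1_eq_iff:
  assumes "1/14 \<le> \<alpha>" "\<alpha> < 1/7" "k \<in> adm" "l \<in> adm"
  shows "knead \<alpha> (Suc 0) k = knead \<alpha> (Suc 0) l \<longleftrightarrow> even k = even l"
  using assms by (simp add: knead_Suc_eq_iff knead_level_0 knead_level_1)

text \<open>Repeated doubling leads down to level 1, where the first letter is the parity. At level
  \<open>m\<close> the even coordinates are the points of level \<open>m - 1\<close>, so neither
  identification glues an old point directly to a new one.\<close>

lemma knead_eq_imp_even_iff:
  assumes "1/14 \<le> \<alpha>" "\<alpha> < 1/7" "k \<in> adm" "l \<in> adm" "m \<ge> 1"
    and "knead \<alpha> m k = knead \<alpha> m l"
  shows "even k \<longleftrightarrow> even l"
proof -
  have "knead \<alpha> (Suc n) k = knead \<alpha> (Suc n) l \<Longrightarrow> even k \<longleftrightarrow> even l" for n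
    by (induction n) (use assms knead_1_eq_iff in \<open>auto simp: knead_Suc_eq_iff\<close>)
  then show ?thesis using assms(5,6) by (cases m) auto
qed

section \<open>Cut points and the Rabbit identification\<close>

lemma half_index_mono: "k \<le> l \<Longrightarrow> half_index \<alpha> m k \<le> half_index \<alpha> m l"
  unfolding half_index_def by (intro ceiling_mono) (simp add: divide_right_mono)

lemma half_index_le_iff: "half_index \<alpha> m k \<le> s \<longleftrightarrow> 2 * of_int k \<le> 7 * 2 ^ m * (of_int s + 2 * \<alpha>)"
  unfolding half_index_def ceiling_le_iff by (simp add: field_simps)

lemma half_index_less_iff: "s < half_index \<alpha> m k \<longleftrightarrow> 7 * 2 ^ m * (of_int s + 2 * \<alpha>) < 2 * of_int k"
  using half_index_le_iff[of \<alpha> m k s] by linarith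

text \<open>The index can change from \<open>k\<close> to \<open>l\<close> only if some cut point
  \<open>\<alpha> + s/2\<close>, measured in units of the level, lies in \<open>[k, l)\<close>; the
  second assumption excludes this.\<close>

lemma half_index_eqI:
  assumes "k \<le> l"
    and "\<And>s. 2 * of_int k \<le> 7 * 2 ^ m * (of_int s + 2 * \<alpha>) \<Longrightarrow>
      7 * 2 ^ m * (of_int s + 2 * \<alpha>) < 2 * of_int l \<Longrightarrow> False"
  shows "half_index \<alpha> m k = half_index \<alpha> m l"
  using assms(2)[of "half_index \<alpha> m k"] half_index_mono[OF assms(1), of \<alpha> m]
  unfolding half_index_le_iff [symmetric] half_index_less_iff [symmetric] by force

lemma pow2_mod_7_cases: "(2 ^ n :: int) mod 7 \<in> {1, 2, 4}"
proof (induction n)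
  case (Suc n)
  have "2 ^ Suc n mod 7 = (2 * (2 ^ n mod 7)) mod (7 :: int)" by (simp add: mod_mult_right_eq)
  with Suc show ?case by auto
qed simp

text \<open>The residue 8 modulo 14 describes the left end of a doubled edge of type 3. At level 1
  the three points agree because they are all odd. At later levels the Rabbit cut points are
  themselves old admissible points, and the gap contains none strictly inside, so the three points
  always receive the same letter.\<close>

lemma rabbit_gap:
  assumes "a mod 14 = 8"
  shows "m \<ge> 1 \<Longrightarrow> knead (1/14) m (a + 1) = knead (1/14) m (a + 7)
    \<and> knead (1/14) m (a + 3) = knead (1/14) m (a + 7)"
proof (induction m rule: nat_induct_at_least)
  case base
  have "a + 1 \<in> adm" "a + 3 \<in> adm" "a + 7 \<in> adm"
    using assms by (auto simp: adm_def; presburger)+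
  moreover have "even a" using assms by presburger
  ultimately show ?case
    using knead_1_eq_iff[of "1/14" "a + 1" "a + 7"] knead_1_eq_iff[of "1/14" "a + 3" "a + 7"]
    by simp
next
  case (Suc m)
  have "half_index (1/14) (Suc m) (a + 1) = half_index (1/14) (Suc m) (a + 7)"
  proof (rule half_index_eqI)
    fix s :: int
    assume *: "2 * of_int (a + 1) \<le> 7 * 2 ^ Suc m * (of_int s + 2 * (1/14 :: real))"
      "7 * 2 ^ Suc m * (of_int s + 2 * (1/14 :: real)) < 2 * of_int (a + 7)"
    \<comment> \<open>\<open>P\<close> is the coordinate of the cut point \<open>1/14 + s/2\<close>
      at level \<open>Suc m\<close>. It is even and congruent to \<open>2 ^ m\<close> modulo 7,
      whereas the even numbers between \<open>a + 1\<close> and \<open>a + 7\<close> have residues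
      3, 5 and 0.\<close>
    define P where "P = 2 ^ m * (7 * s + 1)"
    have "7 * 2 ^ Suc m * (of_int s + 2 * (1/14 :: real)) = of_int (2 * P)"
      unfolding P_def by (simp add: field_simps)
    with * have "real_of_int (a + 1) \<le> of_int P" "real_of_int P < of_int (a + 7)" by simp_all
    then have "a + 1 \<le> P" "P < a + 7" by (simp_all only: of_int_le_iff of_int_less_iff)
    moreover have "even P" using \<open>m \<ge> 1\<close> unfolding P_def by simp
    moreover have "even a" using assms by presburger
    ultimately have "P = a + 2 \<or> P = a + 4 \<or> P = a + 6" by presburger
    moreover obtain r where "a = 7 * r + 1"
    proof
      show "a = 7 * (2 * (a div 14) + 1) + 1" using assms by presburger
    qed
    ultimately have "P = 3 + r * 7 \<or> P = 5 + r * 7 \<or> P = 0 + (r + 1) * 7" by auto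
    then have "P mod 7 = 3 \<or> P mod 7 = 5 \<or> P mod 7 = 0"
      by (elim disjE) (simp_all only: mod_mult_self1, simp_all)
    moreover have "P mod 7 \<in> {1, 2, 4}"
    proof -
      have "P = 2 ^ m + 7 * (2 ^ m * s)" unfolding P_def by (simp add: algebra_simps)
      then show ?thesis using pow2_mod_7_cases[of m] by simp
    qed
    ultimately show False by auto
  qed simp
  moreover have "half_index (1/14) (Suc m) (a + 1) \<le> half_index (1/14) (Suc m) (a + 3)"
    "half_index (1/14) (Suc m) (a + 3) \<le> half_index (1/14) (Suc m) (a + 7)"
    by (simp_all add: half_index_mono)
  ultimately have "half_index (1/14) (Suc m) (a + 1) = half_index (1/14) (Suc m) (a + 7)"
    "half_index (1/14) (Suc m) (a + 3) = half_index (1/14) (Suc m) (a + 7)"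
    by linarith+
  with Suc show ?case
    using knead_0_iff[of "1/14" "Suc m"] by (simp add: knead_Suc_eq_iff)
qed

section \<open>Gaps cut by the Dendrite partition\<close>

text \<open>At level \<open>m + 2\<close> one of the cut points \<open>1/12\<close>, \<open>7/12\<close> has coordinate \<open>a + 4/3\<close>, i.e. lies in
  the gap \<open>[a, a + 8]\<close>. By congruences modulo 42 this is the only place where a gap can be cut, and by
  2-adic valuation a gap is cut at no more than one level.\<close>

definition split_gap :: "nat \<Rightarrow> int \<Rightarrow> bool" where
  "split_gap m a \<longleftrightarrow> (\<exists>s. 3 * a + 4 = 7 * 2 ^ m * (1 + 6 * s))"

text \<open>With \<open>a = 14 * q + 8\<close> the bounds are \<open>3 * a\<close> and
  \<open>3 * (a + 8)\<close>. Division by 7 leaves \<open>6 * q + 4\<close>,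
  \<open>6 * q + 5\<close> and \<open>6 * q + 6\<close> for \<open>2 ^ n * (1 + 6 * s)\<close>. The
  last is a multiple of 3; the middle one is odd and 5 modulo 6, but the product is 1 modulo 6 for
  \<open>n = 0\<close> and even otherwise.\<close>

lemma dendrite_gap_crossing:
  fixes q s :: int
  assumes "42 * q + 24 \<le> 7 * 2 ^ n * (1 + 6 * s)" "7 * 2 ^ n * (1 + 6 * s) < 42 * q + 48"
  shows "7 * 2 ^ n * (1 + 6 * s) = 42 * q + 28"
proof -
  define P where "P = 2 ^ n * (1 + 6 * s)"
  have P: "7 * 2 ^ n * (1 + 6 * s) = 7 * P" by (simp add: P_def)
  have "P = 6 * q + 4 \<or> P = 6 * q + 5 \<or> P = 6 * q + 6"
    using assms unfolding P by presburger
  moreover have "\<not> 3 dvd P"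
  proof
    assume "3 dvd P"
    moreover have "coprime (3::int) (2 ^ n)" by simp
    ultimately have "3 dvd 1 + 6 * s"
      unfolding P_def by (simp add: coprime_dvd_mult_right_iff)
    then show False by presburger
  qed
  then have "P \<noteq> 6 * q + 6" by presburger
  moreover have "P \<noteq> 6 * q + 5"
  proof (cases n)
    case 0
    then show ?thesis unfolding P_def by (simp; presburger)
  next
    case (Suc k)
    then have "even P" unfolding P_def by simp
    then show ?thesis by presburger
  qed
  ultimately show ?thesis unfolding P by linarith
qed

text \<open>As \<open>1 + 6 * s\<close> is odd, the level \<open>m\<close> is the 2-adic valuation
  of \<open>3 * a + 4\<close>.\<close>

lemma split_gap_unique: "m < n \<Longrightarrow> split_gap n a \<Longrightarrow> \<not> split_gap m a"
proof
  assume "m < n" "split_gap n a" "split_gap m a"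
  then obtain s t where "(7::int) * 2 ^ n * (1 + 6 * s) = 7 * 2 ^ m * (1 + 6 * t)"
    unfolding split_gap_def by metis
  moreover obtain d where "n = Suc (m + d)" using \<open>m < n\<close> by (metis less_imp_Suc_add)
  ultimately have "7 * 2 ^ m * (2 * (2 ^ d * (1 + 6 * s))) = 7 * 2 ^ m * (1 + 6 * t)"
    by (simp add: power_add mult_ac)
  then have "2 * (2 ^ d * (1 + 6 * s)) = 1 + 6 * t"
    by (subst (asm) mult_cancel_left) simp
  then show False by presburger
qed

text \<open>\<open>14 * 2 ^ m\<close> is half a turn at level \<open>m + 2\<close>, and a half turn
  exchanges the two Dendrite cut points.\<close>

lemma split_gap_shift:
  "split_gap m (a + 14 * 2 ^ m * r) \<longleftrightarrow> split_gap m a"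
proof -
  have "split_gap m (a + 14 * 2 ^ m * r)" if "split_gap m a" for a r
  proof -
    obtain s where "3 * a + 4 = 7 * 2 ^ m * (1 + 6 * s)"
      using \<open>split_gap m a\<close> unfolding split_gap_def by blast
    then have "3 * (a + 14 * 2 ^ m * r) + 4 = 7 * 2 ^ m * (1 + 6 * (s + r))"
      by (simp add: algebra_simps)
    then show ?thesis unfolding split_gap_def by blast
  qed
  from this[of a r] this[of "a + 14 * 2 ^ m * r" "- r"] show ?thesis by auto
qed

lemma dendrite_half_index_crossing:
  assumes "a mod 14 = 8"
    and "2 * of_int a \<le> 7 * 2 ^ Suc (Suc n) * (of_int s + 2 * (1/12 :: real))"
    and "7 * 2 ^ Suc (Suc n) * (of_int s + 2 * (1/12 :: real)) < 2 * of_int (a + 8)"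
  shows "3 * a + 4 = 7 * 2 ^ n * (1 + 6 * s)"
proof -
  define M where "M = 7 * 2 ^ n * (1 + 6 * s)"
  obtain q where q: "a = 14 * q + 8" using assms(1) by (metis mult_div_mod_eq)
  have "7 * 2 ^ Suc (Suc n) * (of_int s + 2 * (1/12 :: real)) = of_int (2 * M) / 3"
    unfolding M_def by (simp add: field_simps)
  with assms(2,3) have "2 * real_of_int a \<le> of_int (2 * M) / 3" "of_int (2 * M) / 3 < 2 * real_of_int (a + 8)"
    by simp_all
  then have "3 * a \<le> M" "M < 3 * (a + 8)" by linarith+
  then have "M = 42 * q + 28"
    using dendrite_gap_crossing[of q n s] unfolding M_def q by simp
  then show ?thesis unfolding M_def q by simp
qed

lemma dendrite_letter_const:
  assumes "a mod 14 = 8" "\<not> split_gap n a" "0 \<le> i" "i \<le> 8"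
  shows "knead (1/12) (Suc (Suc n)) (a + i) 0 = knead (1/12) (Suc (Suc n)) a 0"
proof -
  have "half_index (1/12) (Suc (Suc n)) a = half_index (1/12) (Suc (Suc n)) (a + 8)"
    by (rule half_index_eqI)
      (use assms(1,2) dendrite_half_index_crossing in \<open>force simp: split_gap_def\<close>)+
  moreover have "half_index (1/12) (Suc (Suc n)) a \<le> half_index (1/12) (Suc (Suc n)) (a + i)"
    "half_index (1/12) (Suc (Suc n)) (a + i) \<le> half_index (1/12) (Suc (Suc n)) (a + 8)"
    using assms by (simp_all add: half_index_mono)
  ultimately have "half_index (1/12) (Suc (Suc n)) (a + i) = half_index (1/12) (Suc (Suc n)) a"
    by linarith
  then show ?thesis using knead_0_iff[of "1/12"] by simp
qed

lemma dendrite_letter_split: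
  assumes "split_gap n a"
  shows "knead (1/12) (Suc (Suc n)) (a + 8) 0 \<longleftrightarrow> \<not> knead (1/12) (Suc (Suc n)) a 0"
proof -
  obtain s where s: "3 * a + 4 = 7 * 2 ^ n * (1 + 6 * s)"
    using assms unfolding split_gap_def by blast
  define K :: real where "K = 7 * 2 ^ n"
  \<comment> \<open>Cut points are half a turn apart, that is \<open>2 * K \<ge> 14\<close> units,
    more than the 8 units of the gap. Hence the cut at \<open>a + 4/3\<close> is the only one
    inside, and the index rises by exactly 1.\<close>
  have K: "K \<ge> 7" unfolding K_def by simp
  have N: "7 * 2 ^ Suc (Suc n) = 4 * K" unfolding K_def by simp
  have "real_of_int (3 * a + 4) = of_int (7 * 2 ^ n * (1 + 6 * s))" by (simp only: s)
  then have a: "3 * real_of_int a + 4 = K * (1 + 6 * of_int s)" unfolding K_def by simp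
  have "half_index (1/12) (Suc (Suc n)) a = s"
  proof (rule antisym)
    show "half_index (1/12) (Suc (Suc n)) a \<le> s"
      unfolding half_index_le_iff N using a by (simp add: algebra_simps)
    have "s - 1 < half_index (1/12) (Suc (Suc n)) a"
      unfolding half_index_less_iff N using a K by (simp add: algebra_simps)
    then show "s \<le> half_index (1/12) (Suc (Suc n)) a" by simp
  qed
  moreover have "half_index (1/12) (Suc (Suc n)) (a + 8) = s + 1"
  proof (rule antisym)
    show "half_index (1/12) (Suc (Suc n)) (a + 8) \<le> s + 1"
      unfolding half_index_le_iff N using a K by (simp add: algebra_simps)
    have "s < half_index (1/12) (Suc (Suc n)) (a + 8)"
      unfolding half_index_less_iff N using a by (simp add: algebra_simps)
    then show "s + 1 \<le> half_index (1/12) (Suc (Suc n)) (a + 8)" by simp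
  qed
  ultimately show ?thesis using knead_0_iff[of "1/12"] by simp
qed

lemma gap_adm:
  assumes "a mod 14 = 8" "i \<in> {0, 1, 3, 7, 8}"
  shows "a + i \<in> adm"
proof -
  obtain q where q: "a = 7 * q + 1"
  proof
    show "a = 7 * (2 * (a div 14) + 1) + 1" using assms(1) by presburger
  qed
  have "(a + i) mod 7 = (1 + i) mod 7"
    unfolding q by (metis add.assoc mod_mult_self4)
  then show ?thesis using assms(2) by (auto simp: adm_def)
qed

lemma dendrite_level_1:
  assumes "a mod 14 = 8" "c mod 14 = 8" "i \<in> {0, 1, 3, 7, 8}" "j \<in> {0, 1, 3, 7, 8}" "even i = even j"
  shows "knead (1/12) (Suc 0) (a + i) = knead (1/12) (Suc 0) (c + j)"
proof -
  have "even a" "even c" using assms(1,2) by presburger+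
  then show ?thesis
    using knead_1_eq_iff[of "1/12" "a + i" "c + j"] assms gap_adm by simp
qed

text \<open>Level 1 sees only the parity; every later level up to \<open>Suc n\<close> prepends a
  letter that is constant on a gap not cut there.\<close>

lemma dendrite_gap_unsplit:
  assumes "a mod 14 = 8" "i \<in> {0, 1, 3, 7, 8}" "j \<in> {0, 1, 3, 7, 8}" "even i = even j"
    and "\<And>n'. n' < n \<Longrightarrow> \<not> split_gap n' a"
  shows "knead (1/12) (Suc n) (a + i) = knead (1/12) (Suc n) (a + j)"
  using assms(5)
proof (induction n)
  case 0
  then show ?case using dendrite_level_1[OF assms(1) assms(1-4)] by simp
next
  case (Suc n)
  have "0 \<le> i" "i \<le> 8" "0 \<le> j" "j \<le> 8" using assms(2,3) by auto
  then have "knead (1/12) (Suc (Suc n)) (a + i) 0 = knead (1/12) (Suc (Suc n)) (a + j) 0"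
    using dendrite_letter_const[OF assms(1), of n] Suc.prems[of n] by blast
  then show ?case using Suc by (subst knead_Suc_eq_iff) simp
qed

text \<open>The image of a cut gap under doubling is not cut at any lower level, so its three new points form a
  complete Dendrite class. The second gap is therefore the same or the opposite one, and in the
  opposite one the first letters of the endpoints are exchanged.\<close>

lemma dendrite_split_ends:
  assumes "a mod 14 = 8" "c mod 14 = 8" "i \<in> {1, 3, 7}" "j \<in> {1, 3, 7}" "split_gap n a"
    and eq: "knead (1/12) (Suc n) (a + i) = knead (1/12) (Suc n) (c + j)"
  shows "knead (1/12) (Suc (Suc n)) a = knead (1/12) (Suc (Suc n)) c
      \<and> knead (1/12) (Suc (Suc n)) (a + 8) = knead (1/12) (Suc (Suc n)) (c + 8)
    \<or> knead (1/12) (Suc (Suc n)) a = knead (1/12) (Suc (Suc n)) (c + 8)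
      \<and> knead (1/12) (Suc (Suc n)) (a + 8) = knead (1/12) (Suc (Suc n)) c"
proof -
  have unsplit: "\<And>n'. n' < n \<Longrightarrow> \<not> split_gap n' a"
    using split_gap_unique assms(5) by blast
  \<comment> \<open>With the common offset \<open>j\<close> the residues modulo 7 agree, so
    \<open>knead_inj\<close> makes \<open>c\<close> a translate of \<open>a\<close> by full turns of
    level \<open>Suc n\<close>, which are half turns of level \<open>Suc (Suc n)\<close>.\<close>
  have "knead (1/12) (Suc n) (a + j) = knead (1/12) (Suc n) (c + j)"
    using dendrite_gap_unsplit[of a i j n] unsplit assms by auto
  moreover have "(a + j) mod 7 = (c + j) mod 7"
  proof -
    have "x mod 7 = 1" if "x mod 14 = 8" for x :: int using that by presburger
    then have "a mod 7 = c mod 7" using assms(1,2) by simp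
    then show ?thesis by (rule mod_add_cong) simp
  qed
  ultimately have "pt (Suc n) (a + j) = pt (Suc n) (c + j)"
    using knead_inj[of "1/12" "Suc n" "a + j" "c + j"] by simp
  then have "7 * 2 ^ Suc n dvd (c + j) - (a + j)"
    by (simp only: pt_eq_iff mod_eq_dvd_iff dvd_diff_commute)
  then obtain r where "c - a = 7 * 2 ^ Suc n * r" by (auto elim: dvdE)
  then have r: "c = a + 7 * 2 ^ Suc n * r" by simp
  then have "split_gap n c"
    using split_gap_shift[of n a r] assms(5) by (simp add: mult.assoc)
  have "pt (Suc n) c = pt (Suc n) a" "pt (Suc n) (c + 8) = pt (Suc n) (a + 8)"
    using pt_add_period[of "Suc n" a r] pt_add_period[of "Suc n" "a + 8" r]
    unfolding r by (simp_all add: algebra_simps)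
  moreover have "knead (1/12) (Suc n) a = knead (1/12) (Suc n) (a + 8)"
    using dendrite_gap_unsplit[of a 0 8 n] unsplit assms(1) by simp
  \<comment> \<open>One level lower all four ends have the same sequence, so only the first letters
    matter. They differ at the two ends of each cut gap, which leaves the straight and the crosswise
    matching.\<close>
  ultimately show ?thesis
    using dendrite_letter_split[OF assms(5)] dendrite_letter_split[OF \<open>split_gap n c\<close>]
    unfolding knead_Suc_eq_iff[of _ _ "Suc n"] by auto
qed

text \<open>Induction on the level, starting from parity at level 1. If neither gap is cut, the new
  letter is constant on each and common to both, so the matching of the ends persists. If one is
  cut, \<open>dendrite_split_ends\<close> derives the matching from the equality one level lower,
  without the induction hypothesis.\<close>

lemma dendrite_gap_ends:
  assumes "a mod 14 = 8" "c mod 14 = 8" "i \<in> {1, 3, 7}" "j \<in> {1, 3, 7}"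
    and "knead (1/12) (Suc m) (a + i) = knead (1/12) (Suc m) (c + j)"
  shows "knead (1/12) (Suc m) a = knead (1/12) (Suc m) c
      \<and> knead (1/12) (Suc m) (a + 8) = knead (1/12) (Suc m) (c + 8)
    \<or> knead (1/12) (Suc m) a = knead (1/12) (Suc m) (c + 8)
      \<and> knead (1/12) (Suc m) (a + 8) = knead (1/12) (Suc m) c"
  using assms(5)
proof (induction m)
  case 0
  then show ?case
    using dendrite_level_1[OF assms(1,2), of 0 0] dendrite_level_1[OF assms(1,2), of 8 8] by simp
next
  case (Suc n)
  then have eq: "knead (1/12) (Suc n) (a + i) = knead (1/12) (Suc n) (c + j)"
    and letter: "knead (1/12) (Suc (Suc n)) (a + i) 0 = knead (1/12) (Suc (Suc n)) (c + j) 0"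
    unfolding knead_Suc_eq_iff[of _ _ "Suc n"] by blast+
  consider "split_gap n a" | "split_gap n c" | "\<not> split_gap n a" "\<not> split_gap n c" by blast
  then show ?case
  proof cases
    case 1
    then show ?thesis by (rule dendrite_split_ends[OF assms(1-4) _ eq])
  next
    case 2
    then show ?thesis
      using dendrite_split_ends[OF assms(2,1,4,3) _ eq [symmetric]] by metis
  next
    case 3
    have "0 \<le> i" "i \<le> 8" "0 \<le> j" "j \<le> 8" using assms(3,4) by auto
    then have "knead (1/12) (Suc (Suc n)) (a + 8) 0 = knead (1/12) (Suc (Suc n)) a 0"
      "knead (1/12) (Suc (Suc n)) (c + 8) 0 = knead (1/12) (Suc (Suc n)) c 0"
      "knead (1/12) (Suc (Suc n)) c 0 = knead (1/12) (Suc (Suc n)) a 0"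
      using dendrite_letter_const[OF assms(1) 3(1)] dendrite_letter_const[OF assms(2) 3(2)] letter
      by simp_all
    then show ?thesis
      using Suc.IH[OF eq] unfolding knead_Suc_eq_iff[of _ _ "Suc n"] by metis
  qed
qed

section \<open>Harmonic extensions\<close>

lemma graph_functions_iff:
  "u \<in> graph_functions m \<longleftrightarrow> u \<in> extensional (points m) \<and>
    (\<forall>(x, y) \<in> rabbit_ident m \<union> dendrite_ident m. u x = u y)"
proof -
  \<comment> \<open>The kernel of \<open>u\<close> is an equivalence relation; if it contains the
    generators, it contains the generated relation.\<close>
  define R where "R = {(x, y). x \<in> points m \<and> y \<in> points m \<and> u x = u y}"
  have "equiv (points m) R"
    unfolding R_def by (auto intro!: equivI refl_onI symI transI)
  moreover have sub: "rabbit_ident m \<union> dendrite_ident m \<subseteq> points m \<times> points m"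
    unfolding rabbit_ident_def dendrite_ident_def kneading_ident_def by auto
  ultimately have "mating_ident m \<subseteq> R" if "\<forall>(x, y) \<in> rabbit_ident m \<union> dendrite_ident m. u x = u y"
    using that unfolding mating_ident_def R_def by (intro Inter_lower) auto
  moreover have "rabbit_ident m \<union> dendrite_ident m \<subseteq> mating_ident m"
    unfolding mating_ident_def by blast
  ultimately show ?thesis
    unfolding graph_functions_def R_def by blast
qed

lemma idents_eq:
  "rabbit_ident m \<union> dendrite_ident m = (\<Union>\<alpha> \<in> {1/14, 1/12}. kneading_ident \<alpha> (\<alpha> + 1/2) m)"
  unfolding rabbit_ident_def dendrite_ident_def by simp

lemma graph_functions_eqI:
  assumes "u \<in> extensional (points m)"
    and "\<And>\<alpha> k l. \<alpha> \<in> {1/14, 1/12} \<Longrightarrow> k \<in> adm \<Longrightarrow> l \<in> adm \<Longrightarrow> knead \<alpha> m k = knead \<alpha> m l \<Longrightarrow>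
      u (pt m k) = u (pt m l)"
  shows "u \<in> graph_functions m"
  unfolding graph_functions_iff
proof (intro conjI assms(1) ballI, clarify)
  fix x y assume "(x, y) \<in> rabbit_ident m \<union> dendrite_ident m"
  then obtain \<alpha> :: real where "\<alpha> \<in> {1/14, 1/12}" "(x, y) \<in> kneading_ident \<alpha> (\<alpha> + 1/2) m"
    unfolding idents_eq by blast
  then show "u x = u y"
    using assms(2)[of \<alpha>] unfolding kneading_ident_def points_eq by blast
qed

lemma graph_functions_eqD:
  assumes "u \<in> graph_functions m" "\<alpha> \<in> {1/14, 1/12}" "k \<in> adm" "l \<in> adm"
    and "knead \<alpha> m k = knead \<alpha> m l"
  shows "u (pt m k) = u (pt m l)"
proof -
  have "(pt m k, pt m l) \<in> rabbit_ident m \<union> dendrite_ident m"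
    using assms(2-5) unfolding idents_eq kneading_ident_def points_eq by blast
  then show ?thesis using assms(1) unfolding graph_functions_iff by blast
qed

section \<open>Energies of an extension\<close>

lemma sum_lessThan_double:
  fixes f :: "nat \<Rightarrow> real"
  shows "(\<Sum>l<2 * n. f l) = (\<Sum>l<n. f (2 * l) + f (2 * l + 1))"
  using sum_split_even_odd[of f f n] by (simp add: sum.distrib)

lemma sum_lessThan_cyclic_shift:
  fixes f :: "nat \<Rightarrow> real"
  assumes "f n = f 0"
  shows "(\<Sum>l<n. f (Suc l)) = (\<Sum>l<n. f l)"
  using sum.lessThan_Suc[of f n] sum.lessThan_Suc_shift[of f n] assms by (simp add: add.commute)

text \<open>The odd residues modulo 14 that are admissible modulo 7 are 9, 11 and 1: these are the
  three new points \<open>a + 1\<close>, \<open>a + 3\<close>, \<open>a + 7\<close> of a gap with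
  left end \<open>a = 14 * l + 8\<close>.\<close>

lemma odd_adm_cases:
  assumes "odd k" "k \<in> adm"
  obtains l i where "i \<in> {1, 3, 7}" "k = 14 * l + 8 + i"
proof -
  define q r where "q = (k - 9) div 14" and "r = (k - 9) mod 14"
  have k: "k = 14 * q + 9 + r"
    unfolding q_def r_def using mult_div_mod_eq[of 14 "k - 9"] by linarith
  have "0 \<le> r" "r < 14" unfolding r_def by simp_all
  moreover have "even r" using assms(1) unfolding k by simp
  ultimately have r: "r = 0 \<or> r = 2 \<or> r = 4 \<or> r = 6 \<or> r = 8 \<or> r = 10 \<or> r = 12" by presburger
  have "k = (r + 2) + (2 * q + 1) * 7" unfolding k by simp
  then have "k mod 7 = (r + 2) mod 7" by (simp only: mod_mult_self1)
  then have "r = 0 \<or> r = 2 \<or> r = 6" using r assms(2) by (auto simp: adm_def)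
  then show ?thesis using that[of "r + 1" q] k by auto
qed

text \<open>\<open>7 * l + 4\<close> and \<open>7 * l + 8\<close> are the ends of the edge of type 3
  with index \<open>l\<close>.\<close>

definition midpoint_value :: "nat \<Rightarrow> (real \<Rightarrow> real) \<Rightarrow> int \<Rightarrow> real" where
  "midpoint_value m u l = (u (pt m (7 * l + 4)) + u (pt m (7 * l + 8))) / 2"

lemma new_points_eq:
  assumes "v \<in> graph_functions (Suc m)" "i \<in> {1, 3, 7}"
  shows "v (pt (Suc m) (14 * l + 8 + i)) = v (pt (Suc m) (14 * l + 9))"
proof -
  have a: "(14 * l + 8) mod 14 = 8" by simp
  have "knead (1/14) (Suc m) (14 * l + 8 + i) = knead (1/14) (Suc m) (14 * l + 8 + 1)"
    using rabbit_gap[OF a, of "Suc m"] assms(2) by auto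
  then have "v (pt (Suc m) (14 * l + 8 + i)) = v (pt (Suc m) (14 * l + 8 + 1))"
    using graph_functions_eqD[OF assms(1), of "1/14"] gap_adm[OF a] assms(2) by blast
  then show ?thesis by (simp add: add.assoc)
qed

text \<open>At level \<open>Suc m\<close> half of the edges of types 2 and 3 are doubled edges of
  types 1 and 2; the others join new points of one gap and contribute nothing. The edges of type 1
  are the first and last arcs \<open>[a, a + 1]\<close> and \<open>[a + 7, a + 8]\<close> of the
  gaps.\<close>

lemma energy_extension:
  assumes v: "v \<in> graph_functions (Suc m)" and agree: "\<forall>x \<in> points m. v x = u x"
  shows "energy 1 (Suc m) v = 4 * energy 3 m u +
      28 * 2 ^ m * (\<Sum>l<2 ^ m. (v (pt (Suc m) (14 * int l + 9)) - midpoint_value m u (int l))\<^sup>2)"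
    and "energy 2 (Suc m) v = energy 1 m u"
    and "energy 3 (Suc m) v = energy 2 m u"
proof -
  define U where "U k = v (pt (Suc m) k)" for k
  have U_old: "U (2 * k) = u (pt m k)" if "k \<in> adm" for k
    unfolding U_def pt_Suc_double using that agree points_eq by auto
  have U_new: "U (14 * l + 11) = U (14 * l + 9)" "U (14 * l + 15) = U (14 * l + 9)" for l
    using new_points_eq[OF v, of 3 l] new_points_eq[OF v, of 7 l] unfolding U_def by (simp_all add: add.commute)
  have U_comm: "U (numeral n + 14 * l) = U (14 * l + numeral n)" for n l
    by (simp add: add.commute)
  have E: "energy (Suc i) (Suc m) v = 14 * 2 ^ m / 2 ^ i * (\<Sum>l<2 ^ m.
      (U (14 * int l + 2 ^ i) - U (14 * int l + 2 ^ Suc i))\<^sup>2 +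
      (U (14 * int l + 7 + 2 ^ i) - U (14 * int l + 7 + 2 ^ Suc i))\<^sup>2)" if "i < 3" for i
    using energy_eq[OF that, of "Suc m" v]
    unfolding U_def [symmetric] power_Suc [of 2 m] sum_lessThan_double
    by (simp add: algebra_simps)
  have U4: "U (14 * l + 4) = u (pt m (7 * l + 2))" for l
    using U_old[of "7 * l + 2"] pow2_in_adm[of 1 l] by (simp add: algebra_simps)
  have U8: "U (14 * l + 8) = u (pt m (7 * l + 4))" for l
    using U_old[of "7 * l + 4"] pow2_in_adm[of 2 l] by (simp add: algebra_simps)
  have U2: "U (14 * l + 2) = u (pt m (7 * l + 1))" for l
    using U_old[of "7 * l + 1"] pow2_in_adm[of 0 l] by (simp add: algebra_simps)
  have U16: "U (14 * l + 16) = u (pt m (7 * l + 8))" for l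
    using U2[of "l + 1"] by (simp add: algebra_simps)
  show "energy 2 (Suc m) v = energy 1 m u"
    using E[of 1] energy_eq[of 0 m u] by (simp add: numeral_2_eq_2 [symmetric] U2 U4 U_new U_comm)
  show "energy 3 (Suc m) v = energy 2 m u"
    using E[of 2] energy_eq[of 1 m u]
    by (simp add: numeral_2_eq_2 [symmetric] numeral_3_eq_3 [symmetric] U8 U4 U_new U_comm)
  let ?A = "\<lambda>l. u (pt m (7 * int l + 4))" and ?B = "\<lambda>l. u (pt m (7 * int l + 8))"
    and ?X = "\<lambda>l. U (14 * int l + 9)"
  \<comment> \<open>The edge from \<open>14 * l + 1\<close> to \<open>14 * l + 2\<close> closes the
    preceding gap; a cyclic shift of the index attaches it to the gap whose first arc starts at
    \<open>14 * l + 8\<close>.\<close>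
  have "(\<Sum>l<2 ^ m. (U (14 * int l + 1) - U (14 * int l + 2))\<^sup>2)
      = (\<Sum>l<2 ^ m. (U (14 * int (Suc l) + 1) - U (14 * int (Suc l) + 2))\<^sup>2)"
  proof (rule sum_lessThan_cyclic_shift [symmetric])
    have "U (14 * int (2 ^ m) + i) = U (14 * int 0 + i)" for i
      unfolding U_def using pt_add_period[of "Suc m" i 1] by (simp add: add.commute)
    then show "(U (14 * int (2 ^ m) + 1) - U (14 * int (2 ^ m) + 2))\<^sup>2
        = (U (14 * int 0 + 1) - U (14 * int 0 + 2))\<^sup>2" by simp
  qed
  also have "\<dots> = (\<Sum>l<2 ^ m. (?X l - ?B l)\<^sup>2)"
    using U16 U_new(2) by (intro sum.cong) (simp_all add: algebra_simps)
  finally have "energy 1 (Suc m) v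
      = 14 * 2 ^ m * (\<Sum>l<2 ^ m. (?X l - ?B l)\<^sup>2 + (?A l - ?X l)\<^sup>2)"
    using E[of 0] by (simp add: U8 U_comm sum.distrib)
  \<comment> \<open>Completing the square in the new value \<open>?X l\<close> yields half the
    squared difference of the ends plus twice the squared deviation from their mean.\<close>
  also have "(\<lambda>l. (?X l - ?B l)\<^sup>2 + (?A l - ?X l)\<^sup>2)
      = (\<lambda>l. (?A l - ?B l)\<^sup>2 / 2 + 2 * (?X l - midpoint_value m u (int l))\<^sup>2)"
    unfolding midpoint_value_def by (rule ext) (simp add: power2_eq_square field_simps)
  also have "14 * 2 ^ m * (\<Sum>l<2 ^ m. (?A l - ?B l)\<^sup>2 / 2 + 2 * (?X l - midpoint_value m u (int l))\<^sup>2)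
      = 4 * energy 3 m u + 28 * 2 ^ m * (\<Sum>l<2 ^ m. (?X l - midpoint_value m u (int l))\<^sup>2)"
    using energy_eq[of 2 m u]
    by (simp add: numeral_3_eq_3 [symmetric] sum.distrib sum_distrib_left algebra_simps)
  finally show "energy 1 (Suc m) v = 4 * energy 3 m u +
      28 * 2 ^ m * (\<Sum>l<2 ^ m. (v (pt (Suc m) (14 * int l + 9)) - midpoint_value m u (int l))\<^sup>2)"
    unfolding U_def .
qed

section \<open>The midpoint extension\<close>

definition interpolate :: "nat \<Rightarrow> (real \<Rightarrow> real) \<Rightarrow> int \<Rightarrow> real" where
  "interpolate m u k =
    (if even k then u (pt m (k div 2)) else midpoint_value m u ((k - 9) div 14))"

text \<open>On a point \<open>x\<close> the floor merely recovers its integer coordinate. The new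
  points of gap \<open>l\<close> are \<open>14 * l + 9\<close>, \<open>14 * l + 11\<close> and
  \<open>14 * l + 15\<close>, whence the offset 9 in \<open>interpolate\<close>. The restriction
  makes the function extensional, as \<open>graph_functions\<close> demands.\<close>

definition midpoint_extension :: "nat \<Rightarrow> (real \<Rightarrow> real) \<Rightarrow> real \<Rightarrow> real" where
  "midpoint_extension m u =
    restrict (\<lambda>x. interpolate m u \<lfloor>7 * 2 ^ Suc m * x\<rfloor>) (points (Suc m))"

text \<open>Invariance under full turns makes the value depend on the point of the circle
  only.\<close>

lemma interpolate_add_period: "interpolate m u (k + 7 * 2 ^ Suc m * s) = interpolate m u k"
proof -
  have "(k + 7 * 2 ^ Suc m * s - 9) div 14 = (k - 9) div 14 + 2 ^ m * s"
    using div_mult_self1[of 14 "k - 9" "2 ^ m * s"] by (simp add: algebra_simps)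
  moreover have "(k + 7 * 2 ^ Suc m * s) div 2 = k div 2 + 7 * 2 ^ m * s"
    using div_mult_self1[of 2 k "7 * 2 ^ m * s"] by (simp add: algebra_simps)
  moreover have "midpoint_value m u (l + 2 ^ m * s) = midpoint_value m u l" for l
    using pt_add_period[of m "7 * l + 4" s] pt_add_period[of m "7 * l + 8" s]
    unfolding midpoint_value_def by (simp add: algebra_simps)
  ultimately show ?thesis unfolding interpolate_def by simp
qed

lemma midpoint_extension_pt:
  assumes "k \<in> adm"
  shows "midpoint_extension m u (pt (Suc m) k) = interpolate m u k"
proof -
  have "\<lfloor>7 * 2 ^ Suc m * pt (Suc m) k\<rfloor> = k mod (7 * 2 ^ Suc m)"
    unfolding pt_mod by simp
  moreover have "interpolate m u (k mod (7 * 2 ^ Suc m)) = interpolate m u k"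
    using interpolate_add_period[of m u "k mod (7 * 2 ^ Suc m)" "k div (7 * 2 ^ Suc m)"]
    by (simp only: mod_mult_div_eq)
  ultimately show ?thesis
    unfolding midpoint_extension_def using assms points_eq by simp
qed

lemma midpoint_extension_old:
  assumes "x \<in> points m"
  shows "midpoint_extension m u x = u x"
proof -
  obtain k where "k \<in> adm" "x = pt m k" using assms points_eq by blast
  then show ?thesis
    using midpoint_extension_pt[of "2 * k" m u]
    by (simp add: adm_double pt_Suc_double interpolate_def)
qed

lemma midpoint_extension_new:
  assumes "i \<in> {1, 3, 7}"
  shows "midpoint_extension m u (pt (Suc m) (14 * l + 8 + i)) = midpoint_value m u l"
proof -
  have "(14 * l + 8 + i - 9) div 14 = l" using assms by auto
  moreover have "14 * l + 8 + i \<in> adm" using gap_adm[of "14 * l + 8" i] assms by auto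
  moreover have "odd (14 * l + 8 + i)" using assms by auto
  ultimately show ?thesis by (simp add: midpoint_extension_pt interpolate_def)
qed

corollary midpoint_extension_middle:
  "midpoint_extension m u (pt (Suc m) (14 * l + 9)) = midpoint_value m u l"
  using midpoint_extension_new[of 1 m u l] by (simp add: add.commute)

lemma knead_double: "kneading a b (pt (Suc m) (2 * k)) = kneading a b (pt m k)"
  by (simp add: pt_Suc_double)

text \<open>A Rabbit identification of new points stays within one gap of the circle. A Dendrite
  identification matches the ends of the two gaps, perhaps crosswise, and the mean is symmetric in
  them.\<close>

lemma midpoint_value_cong:
  assumes u: "u \<in> graph_functions m"
    and "\<alpha> \<in> {1/14, 1/12}" "i \<in> {1, 3, 7}" "j \<in> {1, 3, 7}"
    and eq: "knead \<alpha> (Suc m) (14 * l + 8 + i) = knead \<alpha> (Suc m) (14 * l' + 8 + j)"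
  shows "midpoint_value m u l = midpoint_value m u l'"
proof -
  let ?a = "14 * l + 8" and ?c = "14 * l' + 8"
  have a: "?a mod 14 = 8" "?c mod 14 = 8" by simp_all
  have ends: "?a = 2 * (7 * l + 4)" "?a + 8 = 2 * (7 * l + 8)"
    "?c = 2 * (7 * l' + 4)" "?c + 8 = 2 * (7 * l' + 8)" by simp_all
  have adm: "7 * l + 4 \<in> adm" "7 * l + 8 \<in> adm" "7 * l' + 4 \<in> adm" "7 * l' + 8 \<in> adm"
    using pow2_in_adm[of 2] pow2_in_adm[of 0 "l + 1"] pow2_in_adm[of 0 "l' + 1"]
    by (simp_all add: algebra_simps)
  consider "\<alpha> = 1/14" | "\<alpha> = 1/12" using assms(2) by blast
  then show ?thesis
  proof cases
    case 1
    \<comment> \<open>Within a gap the Rabbit sequences agree, so both points can be given offset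
      \<open>j\<close>; then \<open>knead_inj\<close> shows that they coincide on the circle, and so
      do the gaps.\<close>
    have "knead (1/14) (Suc m) (?a + j) = knead (1/14) (Suc m) (?a + i)"
      using rabbit_gap[OF a(1), of "Suc m"] assms(3,4) by auto
    then have "knead (1/14) (Suc m) (?a + j) = knead (1/14) (Suc m) (?c + j)"
      using eq unfolding 1 by simp
    moreover have "(?a + j) mod 7 = (?c + j) mod 7"
      by (simp add: mod_eq_dvd_iff)
    ultimately have "pt (Suc m) (?a + j) = pt (Suc m) (?c + j)"
      using knead_inj[of "1/14" "Suc m" "?a + j" "?c + j"] by simp
    then have "7 * 2 ^ Suc m dvd (?a + j) - (?c + j)"
      by (simp only: pt_eq_iff mod_eq_dvd_iff)
    then obtain r where "(?a + j) - (?c + j) = 7 * 2 ^ Suc m * r" by (auto elim: dvdE)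
    then have "7 * l = 7 * l' + 7 * 2 ^ m * r" by simp
    then have "pt m (7 * l + k) = pt m (7 * l' + k)" for k
      using pt_add_period[of m "7 * l' + k" r] by (simp add: algebra_simps)
    then show ?thesis unfolding midpoint_value_def by simp
  next
    case 2
    have "knead (1/12) m (7 * l + 4) = knead (1/12) m (7 * l' + 4) \<and>
        knead (1/12) m (7 * l + 8) = knead (1/12) m (7 * l' + 8) \<or>
        knead (1/12) m (7 * l + 4) = knead (1/12) m (7 * l' + 8) \<and>
        knead (1/12) m (7 * l + 8) = knead (1/12) m (7 * l' + 4)"
      using dendrite_gap_ends[OF a assms(3,4), of m] eq
      unfolding 2 ends(2,4) unfolding ends(1,3) knead_double by blast
    then have "u (pt m (7 * l + 4)) = u (pt m (7 * l' + 4)) \<and> u (pt m (7 * l + 8)) = u (pt m (7 * l' + 8)) \<or>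
       u (pt m (7 * l + 4)) = u (pt m (7 * l' + 8)) \<and> u (pt m (7 * l + 8)) = u (pt m (7 * l' + 4))"
      using graph_functions_eqD[OF u, of "1/12"] adm by blast
    then show ?thesis unfolding midpoint_value_def by auto
  qed
qed

lemma midpoint_extension_in_extensions:
  assumes u: "u \<in> graph_functions m"
  shows "midpoint_extension m u \<in> extensions (Suc m) u"
proof -
  have "midpoint_extension m u \<in> graph_functions (Suc m)"
  proof (rule graph_functions_eqI)
    show "midpoint_extension m u \<in> extensional (points (Suc m))"
      unfolding midpoint_extension_def by simp
    fix \<alpha> :: real and k l
    assume \<alpha>: "\<alpha> \<in> {1/14, 1/12}" and k: "k \<in> adm" and l: "l \<in> adm"
      and eq: "knead \<alpha> (Suc m) k = knead \<alpha> (Suc m) l"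
    have "even k \<longleftrightarrow> even l"
      using knead_eq_imp_even_iff[OF _ _ k l _ eq] \<alpha> by auto
    then consider "even k" "even l" | "odd k" "odd l" by blast
    then show "midpoint_extension m u (pt (Suc m) k) = midpoint_extension m u (pt (Suc m) l)"
    proof cases
      case 1
      then obtain k' l' where kl: "k = 2 * k'" "l = 2 * l'" by (elim evenE)
      then have "k' \<in> adm" "l' \<in> adm" using k l by (simp_all add: adm_double)
      moreover from this have "u (pt m k') = u (pt m l')"
        using graph_functions_eqD[OF u \<alpha>] eq unfolding kl knead_double by blast
      ultimately show ?thesis
        unfolding kl pt_Suc_double by (simp add: midpoint_extension_old points_eq)
    next
      case 2
      obtain p i where p: "i \<in> {1, 3, 7}" "k = 14 * p + 8 + i"
        using odd_adm_cases[OF 2(1) k] by blast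
      obtain q j where q: "j \<in> {1, 3, 7}" "l = 14 * q + 8 + j"
        using odd_adm_cases[OF 2(2) l] by blast
      show ?thesis
        using midpoint_value_cong[OF u \<alpha> p(1) q(1)] eq
        unfolding p(2) q(2) midpoint_extension_new[OF p(1)] midpoint_extension_new[OF q(1)] by blast
    qed
  qed
  then show ?thesis
    unfolding extensions_def by (simp add: midpoint_extension_old)
qed

text \<open>Old values are prescribed and the Rabbit identification glues the three new points of
  each gap, so an extension has one free value per gap, read off at
  \<open>14 * l + 9\<close>.\<close>

lemma extension_eqI:
  assumes v: "v \<in> extensions (Suc m) u"
    and u: "u \<in> graph_functions m"
    and mid: "\<And>l::nat. l < 2 ^ m \<Longrightarrow> v (pt (Suc m) (14 * int l + 9)) = midpoint_value m u (int l)"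
  shows "v = midpoint_extension m u"
proof (rule extensionalityI)
  have v': "v \<in> graph_functions (Suc m)" "\<forall>x \<in> points m. v x = u x"
    using v by (simp_all add: extensions_def)
  show "v \<in> extensional (points (Suc m))" using v'(1) by (simp add: graph_functions_def)
  show "midpoint_extension m u \<in> extensional (points (Suc m))"
    unfolding midpoint_extension_def by simp
  fix x assume "x \<in> points (Suc m)"
  then obtain k where k: "k \<in> adm" "x = pt (Suc m) k" unfolding points_eq by blast
  show "v x = midpoint_extension m u x"
  proof (cases "even k")
    case True
    then obtain k' where "k = 2 * k'" by (elim evenE)
    then have "x \<in> points m" using k by (simp add: adm_double pt_Suc_double points_eq)
    then show ?thesis using v'(2) by (simp add: midpoint_extension_old)
  next
    case False
    then obtain p i where p: "i \<in> {1, 3, 7}" "k = 14 * p + 8 + i"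
      using odd_adm_cases k by blast
    define l where "l = nat (p mod 2 ^ m)"
    have l: "int l = p mod 2 ^ m" "l < 2 ^ m" unfolding l_def by (simp_all add: nat_less_iff)
    have pl: "p = int l + 2 ^ m * (p div 2 ^ m)" unfolding l(1) by simp
    have "k = (14 * int l + 8 + i) + 7 * 2 ^ Suc m * (p div 2 ^ m)"
      unfolding p(2) by (subst pl) (simp add: algebra_simps)
    then have x: "x = pt (Suc m) (14 * int l + 8 + i)"
      unfolding k(2) by (simp only: pt_add_period)
    have "v x = v (pt (Suc m) (14 * int l + 9))"
      unfolding x by (rule new_points_eq[OF v'(1) p(1)])
    also have "\<dots> = midpoint_extension m u x"
      unfolding x midpoint_extension_new[OF p(1)] by (rule mid[OF l(2)])
    finally show ?thesis .
  qed
qed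

section \<open>Minimality and renormalization\<close>

lemma weighted_energy_extension:
  assumes "v \<in> extensions (Suc m) u"
  shows "weighted_energy (Suc m) v =
    4 * energy 3 m u + 4 powr (1/3) * energy 1 m u + 4 powr (2/3) * energy 2 m u +
    28 * 2 ^ m * (\<Sum>l<2 ^ m. (v (pt (Suc m) (14 * int l + 9)) - midpoint_value m u (int l))\<^sup>2)"
  using energy_extension[of v m u] assms unfolding weighted_energy_def extensions_def by simp

text \<open>On the extensions of \<open>u\<close> the weighted energy is a constant plus a positive
  multiple of \<open>?D\<close>. The midpoint extension reaches \<open>?D = 0\<close>, and equality
  there fixes the free value in every gap, which gives existence and uniqueness together.\<close>

lemma is_harmonic_extension_iff:
  assumes u: "u \<in> graph_functions m"
  shows "is_harmonic_extension (Suc m) u v \<longleftrightarrow> v = midpoint_extension m u"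
proof -
  let ?h = "midpoint_extension m u"
  let ?D = "\<lambda>v. \<Sum>l<2 ^ m. (v (pt (Suc m) (14 * int l + 9)) - midpoint_value m u (int l))\<^sup>2"
  have h: "?h \<in> extensions (Suc m) u" by (rule midpoint_extension_in_extensions[OF u])
  have D_h: "?D ?h = 0" by (simp add: midpoint_extension_middle)
  have le_iff: "weighted_energy (Suc m) v \<le> weighted_energy (Suc m) w \<longleftrightarrow> ?D v \<le> ?D w"
    if "v \<in> extensions (Suc m) u" "w \<in> extensions (Suc m) u" for v w
    using that by (simp add: weighted_energy_extension)
  have D_nonneg: "0 \<le> ?D w" for w by (rule sum_nonneg) simp
  show ?thesis
  proof
    assume "is_harmonic_extension (Suc m) u v"
    then have v: "v \<in> extensions (Suc m) u" and "?D v \<le> 0"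
      using h le_iff[of v ?h] D_h unfolding is_harmonic_extension_def by simp_all
    then have "?D v = 0" using D_nonneg[of v] by simp
    then have "v (pt (Suc m) (14 * int l + 9)) = midpoint_value m u (int l)" if "l < 2 ^ m" for l
      using that by (subst (asm) sum_nonneg_eq_0_iff) auto
    then show "v = ?h" by (rule extension_eqI[OF v u])
  next
    assume "v = ?h"
    then show "is_harmonic_extension (Suc m) u v"
      using h le_iff[OF h] D_h D_nonneg unfolding is_harmonic_extension_def by simp
  qed
qed

lemma energy_midpoint_extension:
  assumes "u \<in> graph_functions m"
  shows "energy 1 (Suc m) (midpoint_extension m u) = 4 * energy 3 m u"
    and "energy 2 (Suc m) (midpoint_extension m u) = energy 1 m u"
    and "energy 3 (Suc m) (midpoint_extension m u) = energy 2 m u"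
  using energy_extension[of "midpoint_extension m u" m u] midpoint_extension_in_extensions[OF assms]
  by (simp_all add: extensions_def midpoint_extension_middle)

text \<open>The factor \<open>4 powr (- (1/3))\<close> turns the coefficients 4,
  \<open>4 powr (1/3)\<close>, \<open>4 powr (2/3)\<close> of the old energies of types 3, 1, 2 into
  their own weights \<open>4 powr (2/3)\<close>, 1, \<open>4 powr (1/3)\<close>.\<close>

lemma renormalized_energy_eqI:
  assumes "energy 1 (Suc m) v = 4 * energy 3 m u"
    and "energy 2 (Suc m) v = energy 1 m u"
    and "energy 3 (Suc m) v = energy 2 m u"
  shows "renormalized_energy (Suc m) v = renormalized_energy m u"
proof -
  have p: "4 powr (- real (Suc m) / 3) = 4 powr (- real m / 3) * 4 powr (- (1/3) :: real)"
    by (subst powr_add [symmetric]) (simp add: field_simps)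
  have "4 powr (- (1/3)) * 4 = (4 powr (- (1/3)) * 4 powr 1 :: real)" by simp
  also have "\<dots> = 4 powr (2/3)" by (subst powr_add [symmetric]) simp
  finally have p1: "4 powr (- (1/3)) * 4 = (4 powr (2/3) :: real)" .
  have p2: "4 powr (- (1/3)) * 4 powr (1/3) = (1 :: real)"
    by (subst powr_add [symmetric]) simp
  have p3: "4 powr (- (1/3)) * 4 powr (2/3) = (4 powr (1/3) :: real)"
    by (subst powr_add [symmetric]) simp
  have "4 powr (- (1/3)) * weighted_energy (Suc m) v
      = (4 powr (- (1/3)) * 4) * energy 3 m u + (4 powr (- (1/3)) * 4 powr (1/3)) * energy 1 m u
        + (4 powr (- (1/3)) * 4 powr (2/3)) * energy 2 m u"
    unfolding weighted_energy_def assms by (simp only: distrib_left mult.assoc)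
  also have "\<dots> = weighted_energy m u"
    unfolding p1 p2 p3 weighted_energy_def by simp
  finally show ?thesis
    unfolding renormalized_energy_def p by (simp only: mult.assoc)
qed

theorem mainTheorem3:
  fixes m :: nat and u :: "real \<Rightarrow> real"
  assumes "m \<ge> 2" and "u \<in> graph_functions (m - 1)"
  shows "(\<exists>!v. is_harmonic_extension m u v) \<and>
    (\<forall>v. is_harmonic_extension m u v \<longrightarrow>
       energy 1 m v = 4 * energy 3 (m - 1) u \<and>
       energy 2 m v = energy 1 (m - 1) u \<and>
       energy 3 m v = energy 2 (m - 1) u \<and>
       renormalized_energy m v = renormalized_energy (m - 1) u)"
proof -
  define n where "n = m - 1"
  have m: "m = Suc n" "m - 1 = n" using assms(1) unfolding n_def by simp_all
  have u: "u \<in> graph_functions n" using assms(2) unfolding m(2) .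
  note energies = energy_midpoint_extension[OF u]
  show ?thesis
    unfolding m(2) unfolding m(1) is_harmonic_extension_iff[OF u]
    using energies renormalized_energy_eqI[OF energies] by blast
qed

end
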